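(* Let $\ell$ be a positive integer, let $p\geq 5$ be a prime, and let $r$ be an integer with $0<r<p$ such that $24r+1$ is a quadratic nonresidue modulo $p$. Then for all integers $n\geq 0$, $$\phi_{p\ell-1}(pn+r)\equiv 0 \pmod{2},$$ where $\phi_k(n)$ denotes Andrews' generalized Frobenius partition function (defined in the context).
   Context: For a positive integer $k$, a generalized Frobenius partition of $n$ with at most $k$ repetitions (Andrews, 1984) is a two-rowed array $$\begin{pmatrix} a_1 & a_2 & \cdots & a_s\\ b_1 & b_2 & \cdots & b_s\end{pmatrix}$$ with $s\ge 0$, where each row is a nonincreasing sequence of nonnegative integers in which each integer appears at most $k$ times, and $n=s+\sum_{i=1}^s a_i+\sum_{i=1}^s b_i$. Then $\phi_k(n)$ is the number of such arrays for $n$. Equivalently, $\sum_{n\ge0}\phi_k(n)q^n$ is the constant term (coefficient of $z^0$) of $$\prod_{m=0}^{\infty}\Big(1+zq^{m+1}+z^2q^{2(m+1)}+\cdots+z^kq^{k(m+1)}\Big)\Big(1+z^{-1}q^{m}+z^{-2}q^{2m}+\cdots+z^{-k}q^{km}\Big).$$ *)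

theory Defs
  imports "HOL-Number_Theory.Number_Theory"
begin

definition frob_row :: "nat \<Rightarrow> nat list \<Rightarrow> bool" where
  "frob_row k xs \<longleftrightarrow> sorted_wrt (\<ge>) xs \<and> (\<forall>x. count_list xs x \<le> k)"

definition gen_frob_partitions :: "nat \<Rightarrow> nat \<Rightarrow> (nat list \<times> nat list) set" where
  "gen_frob_partitions k n =
     {(as, bs). length as = length bs \<and> frob_row k as \<and> frob_row k bs \<and>
                n = length as + sum_list as + sum_list bs}"

text \<open>Finiteness ensures that \<open>card\<close> below is a genuine count.\<close>

lemma finite_gen_frob_partitions: "finite (gen_frob_partitions k n)"
proof -
  let ?L = "{xs :: nat list. set xs \<subseteq> {..n} \<and> length xs \<le> n}"
  have "gen_frob_partitions k n \<subseteq> ?L \<times> ?L"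
  proof (rule subrelI)
    fix as bs assume "(as, bs) \<in> gen_frob_partitions k n"
    then have *: "length as = length bs" "n = length as + sum_list as + sum_list bs"
      by (auto simp: gen_frob_partitions_def)
    have "set as \<subseteq> {..n}" "set bs \<subseteq> {..n}"
      using *(2) member_le_sum_list[of _ as] member_le_sum_list[of _ bs] by fastforce+
    moreover have "length as \<le> n" "length bs \<le> n"
      using * by simp_all
    ultimately show "(as, bs) \<in> ?L \<times> ?L"
      by simp
  qed
  moreover have "finite ?L"
    by (rule finite_lists_length_le) simp
  ultimately show ?thesis
    by (meson finite_SigmaI finite_subset)
qed

definition gen_frob_phi :: "nat \<Rightarrow> nat \<Rightarrow> nat" where
  "gen_frob_phi k n = card (gen_frob_partitions k n)"

end

theory Submission
  imports
    Defs
    "HOL-Computational_Algebra.Formal_Power_Series"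
    "HOL-Library.Z2"
    "HOL-Library.Disjoint_Sets"
    "HOL-Library.Nat_Bijection"
begin

text \<open>
  Swapping the two rows is an involution on the arrays, so modulo 2 only the arrays with equal
  rows count. Reading an entry \<open>a\<close> of the row as the odd number \<open>2a + 1\<close>, these are the
  partitions of \<open>n\<close> into odd parts, each used fewer than \<open>N = k + 1\<close> times. With all products over
  \<open>m \<ge> 1\<close>, their generating function is
  \<open>\<Prod>(1 - q^((2m-1)N)) / \<Prod>(1 - q^(2m-1)) \<equiv> \<Prod>(1 - q^((2m-1)N)) \<cdot> \<Prod>(1 - q^m)\<close> modulo 2, because
  \<open>\<Prod>(1 - q^(2m)) \<equiv> \<Prod>(1 - q^m)^2\<close>. For \<open>p dvd N\<close> the first factor is a power series in \<open>q^p\<close>,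
  and by the pentagonal number theorem the exponents \<open>e\<close> in the second one satisfy
  \<open>24e + 1 = (6s \<plusminus> 1)^2\<close>.
\<close>

section \<open>Euler's pentagonal number theorem\<close>

text \<open>D. Shanks, \<open>A short proof of an identity of Euler\<close>, Proc. AMS 2 (1951). The summand for
  \<open>s = 0\<close> is the truncated Euler product, all others are divisible by \<open>x ^ (n + 1)\<close>.\<close>

lemma shanks_identity:
  fixes x :: "'a :: comm_ring_1"
  shows "(\<Sum>s\<le>n. (-1) ^ s * (\<Prod>j=Suc s..n. 1 - x ^ j) * x ^ (s * n + triangle s)) =
    1 + (\<Sum>s<n. (-1) ^ Suc s *
      (x ^ (Suc s * s + triangle (Suc s)) + x ^ (Suc s * Suc s + triangle (Suc s))))"
proof (induction n)
  case 0
  then show ?case by simp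
next
  case (Suc n)
  \<comment> \<open>\<open>T\<close> is the unsigned summand. Raising \<open>n\<close> to
    \<open>Suc n\<close> subtracts \<open>U s + U (Suc s)\<close> from it, which telescopes under
    the alternating sign. \<open>U 0\<close> vanishes because its product contains the factor
    \<open>1 - x ^ 0\<close>; \<open>U (Suc n)\<close> is one of the two new terms on the
    right.\<close>
  define T where "T m s = (\<Prod>j=Suc s..m. 1 - x ^ j) * x ^ (s * m + triangle s)" for m s
  define U where "U s = (\<Prod>j=s..n. 1 - x ^ j) * x ^ (s * n + triangle s)" for s
  have step: "T (Suc n) s = T n s - (U s + U (Suc s))" if "s \<le> n" for s
  proof -
    have "T (Suc n) s = T n s * (1 - x ^ Suc n) * x ^ s"
      using that by (simp add: T_def power_add algebra_simps)
    moreover have "U s = (1 - x ^ s) * T n s"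
      using that by (simp add: U_def T_def prod.atLeast_Suc_atMost mult.assoc)
    moreover have "U (Suc s) = T n s * (x ^ Suc n * x ^ s)"
      by (simp add: U_def T_def power_add algebra_simps)
    ultimately show ?thesis
      by (simp add: algebra_simps)
  qed
  have telescope: "(\<Sum>s\<le>m. (-1) ^ s * (U s + U (Suc s))) = U 0 + (-1) ^ m * U (Suc m)" for m
    by (induction m) (simp_all add: algebra_simps)
  have "U 0 = 0"
    by (simp add: U_def prod.atLeast_Suc_atMost)
  have "(\<Sum>s\<le>Suc n. (-1) ^ s * T (Suc n) s) =
      (\<Sum>s\<le>n. (-1) ^ s * T n s) - (\<Sum>s\<le>n. (-1) ^ s * (U s + U (Suc s)))
      + (-1) ^ Suc n * T (Suc n) (Suc n)"
    by (simp add: step right_diff_distrib sum_subtractf)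
  also have "\<dots> = (\<Sum>s\<le>n. (-1) ^ s * T n s)
      + (-1) ^ Suc n * (U (Suc n) + T (Suc n) (Suc n))"
    unfolding telescope \<open>U 0 = 0\<close> by (simp add: algebra_simps)
  also have "U (Suc n) = x ^ (Suc n * n + triangle (Suc n))"
    by (simp add: U_def)
  also have "T (Suc n) (Suc n) = x ^ (Suc n * Suc n + triangle (Suc n))"
    by (simp add: T_def)
  also have "(\<Sum>s\<le>n. (-1) ^ s * T n s) = 1 + (\<Sum>s<n. (-1) ^ Suc s *
      (x ^ (Suc s * s + triangle (Suc s)) + x ^ (Suc s * Suc s + triangle (Suc s))))"
    using Suc.IH by (simp only: T_def mult.assoc)
  finally show ?case
    by (simp only: T_def mult.assoc sum.lessThan_Suc add.assoc)
qed

lemma double_triangle: "2 * triangle n = n * Suc n"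
  by (induction n) simp_all

text \<open>With \<open>t = s + 1\<close> the exponents are the pentagonal numbers
  \<open>t * (3 * t - 1) / 2\<close> and \<open>t * (3 * t + 1) / 2\<close>; completing the square
  yields \<open>(6 * t - 1)^2\<close> and \<open>(6 * t + 1)^2\<close>.\<close>

lemma pentagonal_squares:
  "24 * int (Suc s * s + triangle (Suc s)) + 1 = (6 * int s + 5)\<^sup>2"
  "24 * int (Suc s * Suc s + triangle (Suc s)) + 1 = (6 * int s + 7)\<^sup>2"
proof -
  have "2 * int (triangle (Suc s)) = (int s + 1) * (int s + 2)"
    using arg_cong[OF double_triangle[of "Suc s"], of int] by (simp add: algebra_simps)
  then show "24 * int (Suc s * s + triangle (Suc s)) + 1 = (6 * int s + 5)\<^sup>2"
    "24 * int (Suc s * Suc s + triangle (Suc s)) + 1 = (6 * int s + 7)\<^sup>2"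
    unfolding of_nat_add of_nat_mult of_nat_Suc power2_eq_square
    by (simp_all add: algebra_simps)
qed

text \<open>Compare coefficients in \<open>shanks_identity\<close> at \<open>fps_X\<close>: on the
  left the terms with \<open>s > 0\<close> start beyond degree \<open>n\<close>, and on the right
  every exponent is pentagonal.\<close>

lemma euler_product_nth_eq_0:
  fixes m n :: nat
  assumes "m \<le> n" and nonsquare: "\<And>z. z\<^sup>2 \<noteq> 24 * int m + 1"
  shows "fps_nth (\<Prod>j=1..n. 1 - fps_X ^ j :: 'a :: comm_ring_1 fps) m = 0"
proof -
  let ?F = "\<lambda>s. (-1) ^ s * (\<Prod>j=Suc s..n. 1 - fps_X ^ j) * fps_X ^ (s * n + triangle s) :: 'a fps"
  \<comment> \<open>This disposes of the constant term \<open>1\<close> in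
    \<open>shanks_identity\<close>.\<close>
  have "m \<noteq> 0"
    using nonsquare[of 1] by auto
  have tail: "fps_nth (?F (Suc s)) m = 0" for s
    using \<open>m \<le> n\<close> by (simp only: fps_X_power_mult_right_nth) simp
  have "fps_nth (\<Sum>s\<le>n. ?F s) m = fps_nth (?F 0) m + (\<Sum>s<n. fps_nth (?F (Suc s)) m)"
    by (simp only: fps_sum_nth fps_add_nth sum.atMost_shift)
  also have "\<dots> = fps_nth (\<Prod>j=1..n. 1 - fps_X ^ j :: 'a fps) m"
    unfolding tail by simp
  finally have "fps_nth (\<Prod>j=1..n. 1 - fps_X ^ j :: 'a fps) m = fps_nth (\<Sum>s\<le>n. ?F s) m" ..
  also have "\<dots> = (\<Sum>s<n. fps_nth ((-1) ^ Suc s *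
      (fps_X ^ (Suc s * s + triangle (Suc s)) + fps_X ^ (Suc s * Suc s + triangle (Suc s))) :: 'a fps) m)"
    unfolding shanks_identity using \<open>m \<noteq> 0\<close> by (simp add: fps_sum_nth)
  also have "\<dots> = 0"
  proof (intro sum.neutral ballI)
    fix s
    have "m \<noteq> Suc s * s + triangle (Suc s)" "m \<noteq> Suc s * Suc s + triangle (Suc s)"
      using nonsquare pentagonal_squares[of s] by metis+
    then show "fps_nth ((-1) ^ Suc s * (fps_X ^ (Suc s * s + triangle (Suc s))
        + fps_X ^ (Suc s * Suc s + triangle (Suc s))) :: 'a fps) m = 0"
      by (cases "even (Suc s)")
         (simp_all only: minus_one_power_iff if_True if_False mult_1 mult_minus1 fps_neg_nth
           fps_add_nth fps_X_power_nth add_0 minus_zero)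
  qed
  finally show ?thesis .
qed

section \<open>Partitions into odd parts of bounded multiplicity\<close>

lemma of_nat_bit_eq_0_iff: "(of_nat n :: bit) = 0 \<longleftrightarrow> even n"
  by (induction n) auto

lemma gen_frob_phi_mod_2:
  "(of_nat (gen_frob_phi k m) :: bit) =
    of_nat (card {as. frob_row k as \<and> length as + 2 * sum_list as = m})"
proof -
  let ?S = "gen_frob_partitions k m"
  let ?D = "{z \<in> ?S. fst z = snd z}"
  \<comment> \<open>Off the diagonal \<open>prod.swap\<close> has no fixed point, and the two
    members of each pair contribute \<open>1 + 1 = 0\<close> in \<open>bit\<close>.\<close>
  have "(\<Sum>z\<in>?S - ?D. 1 :: bit) = 0"
    by (rule sum_involution_eq_0[where h = prod.swap])
       (auto simp: gen_frob_partitions_def)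
  moreover have "(\<Sum>z\<in>?S. 1 :: bit) = (\<Sum>z\<in>?S - ?D. 1) + (\<Sum>z\<in>?D. 1)"
    by (rule sum.subset_diff) (auto simp: finite_gen_frob_partitions)
  ultimately have "(of_nat (gen_frob_phi k m) :: bit) = of_nat (card ?D)"
    by (simp only: gen_frob_phi_def sum_constant mult_1_right add_0)
  also have "?D = (\<lambda>as. (as, as)) ` {as. frob_row k as \<and> length as + 2 * sum_list as = m}"
    by (auto simp: gen_frob_partitions_def)
  also have "card \<dots> = card {as. frob_row k as \<and> length as + 2 * sum_list as = m}"
    by (intro card_image inj_onI) simp
  finally show ?thesis .
qed

lemma sorted_wrt_ge_eqI:
  fixes xs ys :: "'a :: linorder list"
  assumes "sorted_wrt (\<ge>) xs" "sorted_wrt (\<ge>) ys" "mset xs = mset ys"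
  shows "xs = ys"
proof -
  have "sorted (rev xs)" "sorted (rev ys)"
    using assms by (simp_all add: sorted_wrt_rev)
  moreover have "mset (rev xs) = mset (rev ys)"
    using assms by simp
  ultimately have "rev xs = rev ys"
    by (metis properties_for_sort)
  then show ?thesis by simp
qed

text \<open>An entry \<open>i\<close> adds 1 to the length and \<open>2 * i\<close> to the doubled
  sum, hence acts as the odd part \<open>2 * i + 1\<close>.\<close>

lemma length_plus_double_sum_list:
  assumes "set as \<subseteq> {..<M}"
  shows "length as + 2 * sum_list as = (\<Sum>i<M. (2 * i + 1) * count_list as i)"
proof -
  have "length as + 2 * sum_list as = sum_list (map (\<lambda>i. 2 * i + 1) as)"
    by (induction as) simp_all
  also have "\<dots> = (\<Sum>i<M. count_list as i * (2 * i + 1))"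
    using assms by (intro sum_list_map_eq_sum_count2) auto
  finally show ?thesis
    by (simp only: mult.commute)
qed

text \<open>Gives surjectivity of the passage from rows to multiplicity functions. Copies of the new
  largest entry go in front, which keeps the list nonincreasing.\<close>

lemma ex_sorted_list_count:
  fixes g :: "nat \<Rightarrow> nat"
  shows "\<exists>as. sorted_wrt (\<ge>) as \<and> set as \<subseteq> {..<M} \<and> (\<forall>i<M. count_list as i = g i)"
proof (induction M)
  case 0
  then show ?case by (intro exI[of _ "[]"]) simp
next
  case (Suc M)
  then obtain as where as: "sorted_wrt (\<ge>) as" "set as \<subseteq> {..<M}" "\<forall>i<M. count_list as i = g i"
    by blast
  have replicate: "count_list (replicate a b) i = (if i = b then a else 0)" for a b i :: nat
    by (induction a) auto
  have sorted_replicate: "sorted_wrt (\<ge>) (replicate a b)" for a b :: nat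
    by (induction a) auto
  have "M \<notin> set as"
    using as(2) by auto
  with as show ?case
    by (intro exI[of _ "replicate (g M) M @ as"])
       (auto simp: sorted_wrt_append sorted_replicate replicate less_Suc_eq)
qed

text \<open>Expanding the product chooses a multiplicity \<open>j \<le> k\<close> for each part
  \<open>2 * i + 1\<close>. Truncation at \<open>M\<close> loses nothing: a row with entry
  \<open>a\<close> has total at least \<open>2 * a + 1\<close>, so
  \<open>a < m \<le> M\<close>.\<close>

lemma card_odd_partitions:
  assumes "m \<le> M"
  shows "(of_nat (card {as. frob_row k as \<and> length as + 2 * sum_list as = m}) :: 'a :: comm_ring_1) =
    fps_nth (\<Prod>i<M. \<Sum>j\<le>k. fps_X ^ ((2 * i + 1) * j)) m"
proof -
  let ?R = "{as. frob_row k as \<and> length as + 2 * sum_list as = m}"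
  let ?G = "{g \<in> {..<M} \<rightarrow>\<^sub>E {..k}. (\<Sum>i<M. (2 * i + 1) * g i) = m}"
  have set_le: "set as \<subseteq> {..<M}" if "as \<in> ?R" for as
  proof
    fix a assume "a \<in> set as"
    then have "a \<le> sum_list as" "as \<noteq> []"
      using member_le_sum_list by auto
    then have "a < length as + 2 * sum_list as"
      by (cases as) auto
    with that assms show "a \<in> {..<M}" by auto
  qed
  \<comment> \<open>Restriction makes the multiplicity function extensional, matching the index set
    produced by \<open>prod_sum_PiE\<close>.\<close>
  have "bij_betw (\<lambda>as. restrict (count_list as) {..<M}) ?R ?G"
  proof (rule bij_betwI')
    fix as bs assume as: "as \<in> ?R" and bs: "bs \<in> ?R"
    show "restrict (count_list as) {..<M} = restrict (count_list bs) {..<M} \<longleftrightarrow> as = bs"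
    proof
      assume eq: "restrict (count_list as) {..<M} = restrict (count_list bs) {..<M}"
      have "count_list as i = count_list bs i" for i
      proof (cases "i < M")
        case True
        then show ?thesis using fun_cong[OF eq, of i] by simp
      next
        case False
        then have "i \<notin> set as" "i \<notin> set bs"
          using set_le[OF as] set_le[OF bs] by auto
        then show ?thesis by simp
      qed
      then have "mset as = mset bs"
        by (simp add: multiset_eq_iff count_mset)
      then show "as = bs"
        using as bs by (intro sorted_wrt_ge_eqI) (auto simp: frob_row_def)
    qed simp
  next
    fix as assume as: "as \<in> ?R"
    then show "restrict (count_list as) {..<M} \<in> ?G"
      using length_plus_double_sum_list[OF set_le[OF as]] by (auto simp: frob_row_def)
  next
    fix g assume g: "g \<in> ?G"
    obtain as where as: "sorted_wrt (\<ge>) as" "set as \<subseteq> {..<M}" "\<forall>i<M. count_list as i = g i"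
      using ex_sorted_list_count by blast
    have "count_list as i \<le> k" for i
    proof (cases "i < M")
      case True
      then show ?thesis using as(3) g by (auto simp: PiE_iff)
    next
      case False
      then have "i \<notin> set as" using as(2) by auto
      then show ?thesis by simp
    qed
    moreover have "length as + 2 * sum_list as = m"
      using length_plus_double_sum_list[OF as(2)] as(3) g by simp
    moreover have "g = restrict (count_list as) {..<M}"
      using g as(3) by (intro ext) (auto simp: PiE_iff extensional_def)
    ultimately show "\<exists>as\<in>?R. g = restrict (count_list as) {..<M}"
      using as(1) by (auto simp: frob_row_def)
  qed
  then have "card ?R = card ?G"
    by (rule bij_betw_same_card)
  have "(\<Prod>i<M. \<Sum>j\<le>k. fps_X ^ ((2 * i + 1) * j) :: 'a fps) =
      (\<Sum>g\<in>{..<M} \<rightarrow>\<^sub>E {..k}. fps_X ^ (\<Sum>i<M. (2 * i + 1) * g i))"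
    by (subst prod_sum_PiE) (simp_all add: power_sum)
  also have "fps_nth \<dots> m =
      (\<Sum>g\<in>{..<M} \<rightarrow>\<^sub>E {..k}. if (\<Sum>i<M. (2 * i + 1) * g i) = m then 1 else 0)"
    by (simp only: fps_sum_nth fps_X_power_nth eq_commute[of m])
  also have "\<dots> = (\<Sum>g\<in>?G. 1)"
    by (rule sum.inter_filter [symmetric]) (simp add: finite_PiE)
  finally show ?thesis
    by (simp only: \<open>card ?R = card ?G\<close> sum_constant mult_1_right)
qed

section \<open>The generating function modulo 2\<close>

text \<open>Each factor is \<open>1\<close> modulo \<open>fps_X ^ (m + 1)\<close>, so finite
  products can stand in for infinite ones.\<close>

lemma fps_nth_mult_high_factors:
  fixes f :: "'a :: comm_ring_1 fps"
  assumes "finite J" "\<And>j. j \<in> J \<Longrightarrow> m < j"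
  shows "fps_nth (f * (\<Prod>j\<in>J. 1 - fps_X ^ j)) m = fps_nth f m"
  using assms
proof (induction J)
  case (insert j J)
  then have "fps_nth (f * (\<Prod>j\<in>insert j J. 1 - fps_X ^ j)) m =
      fps_nth (f * (\<Prod>j\<in>J. 1 - fps_X ^ j) - f * (\<Prod>j\<in>J. 1 - fps_X ^ j) * fps_X ^ j) m"
    by (simp add: algebra_simps)
  also have "\<dots> = fps_nth (f * (\<Prod>j\<in>J. 1 - fps_X ^ j)) m"
    using insert.prems by (simp add: fps_X_power_mult_right_nth)
  finally show ?case using insert by simp
qed simp

text \<open>The product is a polynomial in \<open>fps_X ^ p\<close>. Each factor shifts the index by
  a multiple of \<open>p\<close>, so the induction must let \<open>n\<close> vary.\<close>

lemma fps_nth_prod_multiples_eq_0: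
  assumes "finite I" "\<not> p dvd n"
  shows "fps_nth (\<Prod>i\<in>I. 1 - fps_X ^ (p * g i) :: 'a :: comm_ring_1 fps) n = 0"
  using assms
proof (induction I arbitrary: n)
  case empty
  then show ?case by (cases "n = 0") auto
next
  case (insert i I)
  have "p * g i \<le> n \<Longrightarrow> \<not> p dvd n - p * g i"
    using insert.prems by (metis dvd_diffD dvd_triv_left)
  with insert show ?case
    by (simp add: left_diff_distrib fps_X_power_mult_nth)
qed

lemma bit_fps_square_one_minus: "(1 - f)\<^sup>2 = 1 - f\<^sup>2" for f :: "bit fps"
proof -
  have "(2 :: bit fps) = 0"
    by (simp add: numeral_fps_const)
  have "(1 - f)\<^sup>2 = 1 - f\<^sup>2 + 2 * (f\<^sup>2 - f)"
    by (simp add: power2_eq_square algebra_simps)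
  then show ?thesis
    unfolding \<open>2 = 0\<close> by simp
qed

lemma bit_odd_partitions_nth:
  assumes "m \<le> M"
  shows "fps_nth (\<Prod>i<M. \<Sum>j<N. fps_X ^ ((2 * i + 1) * j) :: bit fps) m =
    fps_nth ((\<Prod>i<M. 1 - fps_X ^ (N * (2 * i + 1))) * (\<Prod>j=1..M. 1 - fps_X ^ j)) m"
proof -
  define A where "A = (\<Prod>i<M. \<Sum>j<N. fps_X ^ ((2 * i + 1) * j) :: bit fps)"
  define O' where "O' = (\<Prod>i<M. 1 - fps_X ^ (2 * i + 1) :: bit fps)"
  define B where "B = (\<Prod>i<M. 1 - fps_X ^ (N * (2 * i + 1)) :: bit fps)"
  define P where "P n = (\<Prod>j=1..n. 1 - fps_X ^ j :: bit fps)" for n :: nat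
  define Q where "Q = (\<Prod>j=M+1..2*M. 1 - fps_X ^ j :: bit fps)"
  have "A * O' = B"
    unfolding A_def O'_def B_def prod.distrib[symmetric]
  proof (rule prod.cong[OF refl])
    fix i
    show "(\<Sum>j<N. fps_X ^ ((2 * i + 1) * j)) * (1 - fps_X ^ (2 * i + 1)) =
        (1 - fps_X ^ (N * (2 * i + 1)) :: bit fps)"
      using one_diff_power_eq[of "fps_X ^ (2 * i + 1) :: bit fps" N]
      by (simp only: power_mult[symmetric] mult.commute)
  qed
  \<comment> \<open>Sort the factors by the parity of \<open>j\<close>; in characteristic 2 the even
    ones form the square of \<open>P M\<close>.\<close>
  have "P (2 * M) = O' * (\<Prod>j=1..M. 1 - fps_X ^ (2 * j))"
    unfolding P_def O'_def by (induction M) (simp_all add: algebra_simps)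
  also have "(\<Prod>j=1..M. 1 - fps_X ^ (2 * j)) = (P M)\<^sup>2"
    by (simp add: P_def prod_power_distrib bit_fps_square_one_minus
        power_mult[symmetric] mult.commute)
  finally have "P (2 * M) = O' * (P M)\<^sup>2" .
  moreover have "P (2 * M) = P M * Q"
    unfolding P_def Q_def mult_2 by (rule prod.ub_add_nat) simp
  ultimately have "P M * Q = O' * (P M)\<^sup>2"
    by simp
  then have "P M * Q = P M * (O' * P M)"
    by (simp only: power2_eq_square mult_ac)
  moreover have "P M \<noteq> 0"
  proof -
    have "fps_nth (P M) 0 = 1"
      using fps_nth_mult_high_factors[of "{1..M}" 0 1] by (simp add: P_def)
    then show ?thesis by auto
  qed
  \<comment> \<open>Cancelling \<open>P M\<close> in the integral domain of series over
    \<open>bit\<close> leaves \<open>Q = O' * P M\<close>; multiply by \<open>A\<close>. The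
    exponents in \<open>Q\<close> exceed \<open>M\<close>, so \<open>Q\<close> does not affect
    coefficient \<open>m\<close>.\<close>
  ultimately have "A * Q = B * P M"
    using \<open>A * O' = B\<close> by (simp add: mult.assoc)
  moreover have "fps_nth (A * Q) m = fps_nth A m"
    unfolding Q_def using assms by (intro fps_nth_mult_high_factors) auto
  ultimately show ?thesis
    by (simp add: A_def B_def P_def)
qed

theorem theorem3:
  fixes l p r n :: nat
  assumes "l > 0"
    and "prime p" and "p \<ge> 5"
    and "0 < r" and "r < p"
    and "\<not> QuadRes (int p) (24 * int r + 1)"
  shows "[gen_frob_phi (p * l - 1) (p * n + r) = 0] (mod 2)"
proof -
  define m where "m = p * n + r"
  let ?B = "\<Prod>i<m. 1 - fps_X ^ (p * l * (2 * i + 1)) :: bit fps"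
  let ?P = "\<Prod>j=1..m. 1 - fps_X ^ j :: bit fps"
  \<comment> \<open>Positivity of \<open>p * l\<close> matters here, as subtraction on naturals
    truncates at 0.\<close>
  have le_eq: "{..p * l - 1} = {..<p * l}"
    using assms(1,3) by (cases "p * l") auto
  have "(of_nat (gen_frob_phi (p * l - 1) m) :: bit) =
      fps_nth (\<Prod>i<m. \<Sum>j<p * l. fps_X ^ ((2 * i + 1) * j)) m"
    unfolding gen_frob_phi_mod_2 card_odd_partitions[OF order_refl] le_eq ..
  also have "\<dots> = fps_nth (?B * ?P) m"
    by (rule bit_odd_partitions_nth) simp
  also have "\<dots> = (\<Sum>i=0..m. fps_nth ?B i * fps_nth ?P (m - i))"
    by (rule fps_mult_nth)
  also have "\<dots> = 0"
  proof (intro sum.neutral ballI)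
    fix i assume i: "i \<in> {0..m}"
    show "fps_nth ?B i * fps_nth ?P (m - i) = 0"
    proof (cases "p dvd i")
      case False
      then have "fps_nth ?B i = 0"
        using fps_nth_prod_multiples_eq_0[of "{..<m}" p i "\<lambda>i. l * (2 * i + 1)"]
        by (simp only: mult.assoc) simp
      then show ?thesis by simp
    next
      case True
      then obtain c where c: "i = p * c" by auto
      \<comment> \<open>Since \<open>p\<close> divides \<open>i\<close>, \<open>m - i\<close> is
        congruent to \<open>r\<close> modulo \<open>p\<close>; such a \<open>z\<close> would make
        \<open>24 * r + 1\<close> a quadratic residue.\<close>
      have "z\<^sup>2 \<noteq> 24 * int (m - i) + 1" for z
      proof
        assume "z\<^sup>2 = 24 * int (m - i) + 1"
        also have "\<dots> = 24 * int r + 1 + int p * (24 * (int n - int c))"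
          using i by (simp add: c m_def of_nat_diff algebra_simps)
        finally have "[z\<^sup>2 = 24 * int r + 1] (mod int p)"
          by (simp add: cong_def)
        then show False
          using assms(6) by (auto simp: QuadRes_def)
      qed
      then have "fps_nth ?P (m - i) = 0"
        by (intro euler_product_nth_eq_0) auto
      then show ?thesis by simp
    qed
  qed
  finally show ?thesis
    by (simp add: of_nat_bit_eq_0_iff m_def cong_0_iff)
qed

end
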